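(* Let $g$, $q_d$, $\alpha$, $\beta$ be as defined in the context (associated with a real polynomial $p$, an interval $[a,b]$ and a degree $d$). Define $\Delta_\theta=\min\{|\theta-\alpha|,|\theta-\beta|\}$ and $\|g\|_{L_\infty(\phi_1,\phi_2)}=\sup_{\phi\in(\phi_1,\phi_2)}|g(\phi)|$. Then for every $\theta\in[0,\pi]\setminus[\beta,\alpha]$ and every $d\ge2$, $$|q_d(\theta)-g(\theta)|\le\frac{\pi^6\,\|g\|_{L_\infty(0,\pi)}}{2\,\Delta_\theta^4\,(d+2)^3}.$$
   Context: Let $-1\le a<b\le 1$, let $M\ge 1$ be an integer, let $p\in\mathcal P_{M-1}$ (real polynomials of degree at most $M-1$), and let $d$ be a positive integer. Let $h(t)=1$ for $t\in(a,b)$, $h(t)=\frac12$ for $t\in\{a,b\}$, $h(t)=0$ for $t\in[-1,1]\setminus[a,b]$, and $\tilde h(t)=p(t)h(t)$. $T_j$ is the Chebyshev polynomial of the first kind of degree $j$. The Chebyshev--Jackson expansion of degree $d$ is $$F_d(p)(t)=\frac{c_0}{2}+\sum_{j=1}^d\rho_{j,d}\,c_j\,T_j(t),\qquad c_j=\frac2\pi\int_a^b\frac{p(t)T_j(t)}{\sqrt{1-t^2}}\,dt,$$ with Jackson damping factors $$\rho_{j,d}=\frac{\sin((j+1)\alpha_d)}{(d+2)\sin(\alpha_d)}+\Bigl(1-\frac{j+1}{d+2}\Bigr)\cos(j\alpha_d),\qquad \alpha_d=\frac{\pi}{d+2}.$$ Put $\alpha=\arccos(a)$, $\beta=\arccos(b)$,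 so $0\le\beta<\alpha\le\pi$. The $2\pi$-periodic function $g$ is $g(\theta)=\tilde h(\cos\theta)$, i.e. on $[-\pi,\pi]$: $g(\theta)=p(\cos\theta)$ for $\theta\in(-\alpha,-\beta)\cup(\beta,\alpha)$, $g(\theta)=\frac12p(\cos\theta)$ for $\theta\in\{\pm\alpha,\pm\beta\}$, and $g(\theta)=0$ otherwise. Finally $$q_d(\theta)=F_d(p)(\cos\theta)=\frac{c_0}{2}+\sum_{j=1}^d\rho_{j,d}c_j\cos(j\theta).$$ *)

theory Defs
  imports "HOL-Analysis.Analysis" "HOL-Computational_Algebra.Polynomial"
begin

fun cheb_T :: "nat \<Rightarrow> real poly" where
  "cheb_T 0 = 1"
| "cheb_T (Suc 0) = [:0, 1:]"
| "cheb_T (Suc (Suc n)) = [:0, 2:] * cheb_T (Suc n) - cheb_T n"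

(* If a = -1 or b = 1, the integrand is singular at that endpoint; Isabelle's value 0 for
   division by zero there concerns a null set only. *)
definition cheb_coeff :: "real \<Rightarrow> real \<Rightarrow> real poly \<Rightarrow> nat \<Rightarrow> real" where
  "cheb_coeff a b p j =
     2 / pi * integral {a..b} (\<lambda>t. poly p t * poly (cheb_T j) t / sqrt (1 - t\<^sup>2))"

definition jackson_angle :: "nat \<Rightarrow> real" where
  "jackson_angle d = pi / (real d + 2)"

definition jackson_rho :: "nat \<Rightarrow> nat \<Rightarrow> real" where
  "jackson_rho j d =
     sin ((real j + 1) * jackson_angle d) / ((real d + 2) * sin (jackson_angle d))
     + (1 - (real j + 1) / (real d + 2)) * cos (real j * jackson_angle d)"

definition cheb_jackson :: "real \<Rightarrow> real \<Rightarrow> nat \<Rightarrow> real poly \<Rightarrow> real \<Rightarrow> real" where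
  "cheb_jackson a b d p t =
     cheb_coeff a b p 0 / 2
     + (\<Sum>j = 1..d. jackson_rho j d * cheb_coeff a b p j * poly (cheb_T j) t)"

definition step_h :: "real \<Rightarrow> real \<Rightarrow> real \<Rightarrow> real" where
  "step_h a b t = (if t \<in> {a<..<b} then 1 else if t \<in> {a, b} then 1 / 2 else 0)"

definition h_tilde :: "real \<Rightarrow> real \<Rightarrow> real poly \<Rightarrow> real \<Rightarrow> real" where
  "h_tilde a b p t = poly p t * step_h a b t"

definition g_fun :: "real \<Rightarrow> real \<Rightarrow> real poly \<Rightarrow> real \<Rightarrow> real" where
  "g_fun a b p \<theta> = h_tilde a b p (cos \<theta>)"

definition q_fun :: "real \<Rightarrow> real \<Rightarrow> nat \<Rightarrow> real poly \<Rightarrow> real \<Rightarrow> real" where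
  "q_fun a b d p \<theta> = cheb_jackson a b d p (cos \<theta>)"

definition Delta_dist :: "real \<Rightarrow> real \<Rightarrow> real \<Rightarrow> real" where
  "Delta_dist \<alpha> \<beta> \<theta> = min \<bar>\<theta> - \<alpha>\<bar> \<bar>\<theta> - \<beta>\<bar>"

(* A genuine supremum, not an essential one. It is real-valued, hence meaningful only for f
   bounded on a nonempty interval, which is the case for g_fun. *)
definition Linf_norm :: "real \<Rightarrow> real \<Rightarrow> (real \<Rightarrow> real) \<Rightarrow> real" where
  "Linf_norm \<phi>\<^sub>1 \<phi>\<^sub>2 f = (SUP \<phi>\<in>{\<phi>\<^sub>1<..<\<phi>\<^sub>2}. \<bar>f \<phi>\<bar>)"

end

theory Submission
  imports Defs
begin

text \<open>
  With N = d + 2 and \<delta> = \<pi> / N, two summations by parts give the closed form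
  N (cos t - cos \<delta>)^2 S(t) = sin^2 \<delta> cos^2(N t / 2) of the Jackson kernel
  S(t) = 1/2 + \<Sum>j=1..d. \<rho>(j) cos(j t), so S is of size N^-3 away from 0.
  The substitution t = cos \<phi> turns q(\<theta>) into the integral over [\<beta>, \<alpha>] of
  p(cos \<phi>) (S(\<theta> - \<phi>) + S(\<theta> + \<phi>)) / \<pi>, in which both arguments of S are
  at distance at least \<Delta> from 2\<pi>\<int>, while g(\<theta>) = 0. The stated constant needs a gain from
  \<alpha> - \<beta> \<le> \<pi> - \<Delta>: the pointwise bound \<pi>^6 / (4 t^4 N^3) on S can fail for t near \<pi>.
\<close>

section \<open>Elementary sine inequalities\<close>

text \<open>Since sin is concave on [0, pi] and vanishes at 0, its graph lies above chords from the
  origin, so sin x / x decreases. The choice of \<open>y\<close> fixes the constant in the lower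
  bounds for sin used later.\<close>

lemma sin_chord_le:
  fixes x y :: real
  assumes "0 \<le> x" "x \<le> y" "y \<le> pi"
  shows "x * sin y \<le> y * sin x"
proof (cases "y = 0")
  case False
  have conc: "concave_on {0..pi} sin"
  proof (rule f''_le0_imp_concave)
    show "(sin has_real_derivative cos x) (at x)" for x by (rule DERIV_sin)
    show "(cos has_real_derivative - sin x) (at x)" for x by (rule DERIV_cos)
  qed (auto intro: sin_ge_zero)
  from False assms have y: "y > 0" by simp
  have "(1 - x / y) * sin 0 + (x / y) * sin y \<le> sin ((1 - x / y) *\<^sub>R 0 + (x / y) *\<^sub>R y)"
    by (rule concave_onD[OF conc]) (use assms y in auto)
  then show ?thesis using y by (simp add: field_simps)
qed (use assms in auto)

text \<open>Serves to extract a factor \<open>sin u\<close> from a numerator that vanishes together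
  with the denominator.\<close>

lemma abs_sin_of_nat_mult_le:
  fixes u :: real
  shows "\<bar>sin (real n * u)\<bar> \<le> real n * \<bar>sin u\<bar>"
proof (induction n)
  case (Suc n)
  have "\<bar>sin (real (Suc n) * u)\<bar> = \<bar>sin (real n * u) * cos u + cos (real n * u) * sin u\<bar>"
    by (simp add: algebra_simps sin_add)
  also have "\<dots> \<le> \<bar>sin (real n * u)\<bar> * \<bar>cos u\<bar> + \<bar>cos (real n * u)\<bar> * \<bar>sin u\<bar>"
    by (metis abs_mult abs_triangle_ineq)
  also have "\<dots> \<le> \<bar>sin (real n * u)\<bar> * 1 + 1 * \<bar>sin u\<bar>"
    by (intro add_mono mult_mono) auto
  also have "\<dots> \<le> real (Suc n) * \<bar>sin u\<bar>"
    using Suc by (simp add: algebra_simps)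
  finally show ?case .
qed simp

section \<open>Cosine sums and the closed form of the Jackson kernel\<close>

lemma poly_cheb_T_cos: "poly (cheb_T n) (cos x) = cos (real n * x)"
proof (induction n rule: cheb_T.induct)
  case (3 n)
  have "cos (real (Suc n) * x - x) + cos (real (Suc n) * x + x) = 2 * cos x * cos (real (Suc n) * x)"
    unfolding cos_add cos_diff by simp
  then have "cos (real n * x) + cos (real (Suc (Suc n)) * x) = 2 * cos x * cos (real (Suc n) * x)"
    by (simp add: algebra_simps)
  with 3 show ?case by (simp add: algebra_simps)
qed auto

text \<open>As 2 cos t cos(j t) = cos((j+1) t) + cos((j-1) t), multiplying a cosine sum by 2 (cos t
  - c) applies a second-order difference operator to its coefficients. Halving \<open>w 0\<close>
  accounts for the separate lower boundary term; the last two terms come from cutting off at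
  \<open>n\<close>.\<close>

lemma cos_sum_by_parts:
  fixes w :: "nat \<Rightarrow> real" and c t :: real
  shows "2 * (cos t - c) * (w 0 / 2 + (\<Sum>j = 1..n. w j * cos (real j * t)))
    = (w 1 - c * w 0) + (\<Sum>j = 1..n. (w (j + 1) + w (j - 1) - 2 * c * w j) * cos (real j * t))
      + w n * cos (real (n + 1) * t) - w (n + 1) * cos (real n * t)"
proof (induction n)
  case (Suc n)
  have "cos (real (Suc n) * t - t) + cos (real (Suc n) * t + t) = 2 * cos t * cos (real (Suc n) * t)"
    unfolding cos_add cos_diff by simp
  then have *: "cos (real (n + 2) * t) = 2 * cos t * cos (real (n + 1) * t) - cos (real n * t)"
    by (simp add: algebra_simps)
  have "2 * (cos t - c) * (w 0 / 2 + (\<Sum>j = 1..Suc n. w j * cos (real j * t)))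
    = 2 * (cos t - c) * (w 0 / 2 + (\<Sum>j = 1..n. w j * cos (real j * t)))
      + 2 * (cos t - c) * (w (n + 1) * cos (real (n + 1) * t))"
    by (simp add: distrib_left)
  also note Suc
  also have "(w 1 - c * w 0) + (\<Sum>j = 1..n. (w (j + 1) + w (j - 1) - 2 * c * w j) * cos (real j * t))
      + w n * cos (real (n + 1) * t) - w (n + 1) * cos (real n * t)
      + 2 * (cos t - c) * (w (n + 1) * cos (real (n + 1) * t))
    = (w 1 - c * w 0) + ((\<Sum>j = 1..n. (w (j + 1) + w (j - 1) - 2 * c * w j) * cos (real j * t))
        + (w (n + 2) + w n - 2 * c * w (n + 1)) * cos (real (n + 1) * t))
      + w (n + 1) * cos (real (n + 2) * t) - w (n + 2) * cos (real (n + 1) * t)"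
    unfolding * by (simp add: algebra_simps)
  finally show ?case by simp
qed (simp add: algebra_simps)

text \<open>The damped analogue of the Dirichlet kernel. Its constant term is half of
  \<open>jackson_rho 0 d\<close>, which equals 1.\<close>

definition jackson_kernel :: "nat \<Rightarrow> real \<Rightarrow> real" where
  "jackson_kernel d t = 1 / 2 + (\<Sum>j = 1..d. jackson_rho j d * cos (real j * t))"

lemma jackson_angle_bounds:
  assumes "d \<ge> 2"
  shows "0 < jackson_angle d" "jackson_angle d \<le> pi / 4"
  using assms by (auto simp: jackson_angle_def field_simps)

text \<open>The scaled coefficients \<open>w\<close> are resonant: up to a homogeneous solution they
  are a linear factor times a solution of the recurrence with characteristic roots exp(i \<delta>)
  and exp(-i \<delta>). One difference operator sends \<open>w\<close> to a multiple of
  \<open>u\<close>, a second one annihilates \<open>u\<close>, and only boundary terms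
  remain.\<close>

lemma jackson_kernel_closed_form:
  assumes "d \<ge> 2"
  defines "N \<equiv> real d + 2" and "\<delta> \<equiv> jackson_angle d"
  shows "N * (cos t - cos \<delta>)\<^sup>2 * jackson_kernel d t = (sin \<delta>)\<^sup>2 * (cos (N * t / 2))\<^sup>2"
proof -
  have N: "N > 0" by (simp add: N_def)
  have N\<delta>: "N * \<delta> = pi" by (simp add: N_def \<delta>_def jackson_angle_def)
  have \<delta>: "0 < \<delta>" "\<delta> < pi"
    using jackson_angle_bounds[OF assms(1)] pi_gt_zero unfolding \<delta>_def by linarith+
  have s: "sin \<delta> > 0" using \<delta> by (rule sin_gt_zero)
  define c where "c = cos \<delta>"
  \<comment> \<open>This is N times the damping factor: expanding sin((j+1) \<delta>) contributes
    one more cos(j \<delta>), which turns the factor N - j - 1 into N - j.\<close>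
  define w where "w j = (N - real j) * cos (real j * \<delta>) + c / sin \<delta> * sin (real j * \<delta>)" for j :: nat
  define u where "u j = sin (real j * \<delta>)" for j :: nat
  \<comment> \<open>The sum runs to \<open>d + 1\<close> because \<open>u (d + 1)\<close> is
    nonzero. The kernel sum is padded to the same length at no cost, and its upper boundary terms
    then contain only the zeros \<open>w (d + 1)\<close> and \<open>w (d + 2)\<close>.\<close>
  define V where "V = (\<Sum>j = 1..d+1. u j * cos (real j * t))"
  have w_rho: "N * jackson_rho j d = w j" for j
    using N s
    by (simp add: jackson_rho_def w_def N_def[symmetric] \<delta>_def[symmetric] c_def distrib_right
        sin_add field_simps)
  have ud1: "u (d + 1) = sin \<delta>"
  proof -
    have "real (d + 1) * \<delta> = pi - \<delta>" using N\<delta> by (simp add: N_def algebra_simps)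
    then show ?thesis by (simp add: u_def)
  qed
  have ud2: "u (d + 2) = 0"
  proof -
    have "real (d + 2) * \<delta> = pi" using N\<delta> by (simp add: N_def algebra_simps)
    then show ?thesis by (simp add: u_def)
  qed
  have wd1: "w (d + 1) = 0"
  proof -
    have "real (d + 1) * \<delta> = pi - \<delta>" using N\<delta> by (simp add: N_def algebra_simps)
    then show ?thesis using s by (simp add: w_def c_def N_def)
  qed
  have wd2: "w (d + 2) = 0"
    using ud2 by (simp add: w_def u_def N_def)
  have diff2: "cos (real (j + 1) * \<delta>) = cos (real j * \<delta>) * c - sin (real j * \<delta>) * sin \<delta>"
    "sin (real (j + 1) * \<delta>) = sin (real j * \<delta>) * c + cos (real j * \<delta>) * sin \<delta>"
    for j by (simp_all add: distrib_right cos_add sin_add c_def)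
  have diff2': "cos (real (j - 1) * \<delta>) = cos (real j * \<delta>) * c + sin (real j * \<delta>) * sin \<delta>"
    "sin (real (j - 1) * \<delta>) = sin (real j * \<delta>) * c - cos (real j * \<delta>) * sin \<delta>"
    if "j \<ge> 1" for j using that
    by (simp_all add: of_nat_diff left_diff_distrib cos_diff sin_diff c_def)
  have u_rec: "u (j + 1) + u (j - 1) - 2 * c * u j = 0" if "j \<ge> 1" for j
    using that by (simp only: u_def diff2 diff2') (simp add: algebra_simps)
  \<comment> \<open>The homogeneous parts cancel; only the unit steps of the linear factor survive,
    as cos((j-1) \<delta>) - cos((j+1) \<delta>) = 2 sin \<delta> sin(j \<delta>).\<close>
  have w_rec: "w (j + 1) + w (j - 1) - 2 * c * w j = 2 * sin \<delta> * u j" if "j \<ge> 1" for j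
  proof -
    have "real (j - 1) = real j - 1" "real (j + 1) = real j + 1" using that by auto
    then have "w (j + 1) + w (j - 1) - 2 * c * w j
      = (N - real j - 1) * cos (real (j + 1) * \<delta>) + (N - real j + 1) * cos (real (j - 1) * \<delta>)
        - 2 * c * (N - real j) * cos (real j * \<delta>)
        + c / sin \<delta> * (u (j + 1) + u (j - 1) - 2 * c * u j)"
      by (simp add: w_def u_def algebra_simps)
    also have "\<dots> = (N - real j - 1) * cos (real (j + 1) * \<delta>) + (N - real j + 1) * cos (real (j - 1) * \<delta>)
        - 2 * c * (N - real j) * cos (real j * \<delta>)"
      using u_rec[OF that] by simp
    also have "\<dots> = 2 * sin \<delta> * u j"
      by (simp only: diff2 diff2'[OF that] u_def) (simp add: algebra_simps)
    finally show ?thesis .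
  qed
  have w1: "w 1 = c * w 0"
    using s by (simp add: w_def c_def[symmetric] algebra_simps)
  have NK: "N * jackson_kernel d t = w 0 / 2 + (\<Sum>j = 1..d+1. w j * cos (real j * t))"
  proof -
    have "N * jackson_kernel d t = N / 2 + (\<Sum>j = 1..d. N * jackson_rho j d * cos (real j * t))"
      by (simp add: jackson_kernel_def distrib_left sum_distrib_left mult.assoc)
    then show ?thesis using wd1 by (simp add: w_rho w_def[of 0])
  qed
  have "2 * (cos t - c) * (N * jackson_kernel d t)
     = (w 1 - c * w 0) + (\<Sum>j = 1..d+1. (w (j + 1) + w (j - 1) - 2 * c * w j) * cos (real j * t))
      + w (d+1) * cos (real (d + 1 + 1) * t) - w (d + 1 + 1) * cos (real (d+1) * t)"
    unfolding NK by (rule cos_sum_by_parts)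
  also have "\<dots> = (\<Sum>j = 1..d+1. (w (j + 1) + w (j - 1) - 2 * c * w j) * cos (real j * t))"
    using wd1 wd2 w1 by simp
  also have "\<dots> = (\<Sum>j = 1..d+1. 2 * sin \<delta> * u j * cos (real j * t))"
    by (intro sum.cong refl) (use w_rec in simp)
  also have "\<dots> = 2 * sin \<delta> * V"
    unfolding V_def sum_distrib_left mult.assoc ..
  finally have 1: "(cos t - c) * (N * jackson_kernel d t) = sin \<delta> * V"
    by (simp only: mult.assoc mult_cancel_left) simp
  have "2 * (cos t - c) * V = 2 * (cos t - c) * (u 0 / 2 + (\<Sum>j = 1..d+1. u j * cos (real j * t)))"
    by (simp add: V_def u_def[of 0])
  also have "\<dots> = (u 1 - c * u 0) + (\<Sum>j = 1..d+1. (u (j + 1) + u (j - 1) - 2 * c * u j) * cos (real j * t))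
      + u (d+1) * cos (real (d + 1 + 1) * t) - u (d + 1 + 1) * cos (real (d+1) * t)"
    by (rule cos_sum_by_parts)
  also have "(\<Sum>j = 1..d+1. (u (j + 1) + u (j - 1) - 2 * c * u j) * cos (real j * t)) = 0"
    by (intro sum.neutral ballI) (use u_rec in simp)
  \<comment> \<open>Both ends contribute sin \<delta>: \<open>u 1\<close> at the bottom, and at the
    top \<open>u (d + 1)\<close>, which multiplies cos(N t).\<close>
  also have "(u 1 - c * u 0) + 0 + u (d+1) * cos (real (d + 1 + 1) * t) - u (d + 1 + 1) * cos (real (d+1) * t)
    = sin \<delta> * (1 + cos (N * t))"
  proof -
    have "u 0 = 0" "u 1 = sin \<delta>" by (simp_all add: u_def)
    then show ?thesis using ud1 ud2 by (simp add: N_def algebra_simps)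
  qed
  also have "1 + cos (N * t) = 2 * (cos (N * t / 2))\<^sup>2"
    using cos_double_cos[of "N * t / 2"] by simp
  finally have 2: "(cos t - c) * V = sin \<delta> * (cos (N * t / 2))\<^sup>2"
    by (simp only: mult.assoc mult.left_commute[of "sin \<delta>" 2] mult_cancel_left) simp
  have "N * (cos t - c)\<^sup>2 * jackson_kernel d t = (cos t - c) * ((cos t - c) * (N * jackson_kernel d t))"
    by (simp add: power2_eq_square)
  also have "\<dots> = sin \<delta> * ((cos t - c) * V)" using 1 by simp
  also have "\<dots> = (sin \<delta>)\<^sup>2 * (cos (N * t / 2))\<^sup>2" using 2 by (simp add: power2_eq_square)
  finally show ?thesis unfolding c_def .
qed

section \<open>Size of the Jackson kernel on (0, pi]\<close>

text \<open>
  Near the double zero \<delta> of the denominator in the closed form, the zero of the numerator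
  cos(n t / 2) = sin(n (\<delta> - t) / 2) compensates; for t above 8\<delta>/5 it can be ignored.
\<close>
lemma cos_half_mult_le:
  fixes t :: real
  assumes "n \<ge> 4" "0 < t" "t \<le> pi / 2"
  defines "\<delta> \<equiv> pi / real n"
  shows "2 * \<bar>cos (real n * t / 2)\<bar> * t\<^sup>2 \<le> pi\<^sup>2 * \<bar>cos t - cos \<delta>\<bar>"
\<comment> \<open>The threshold for t / \<delta> must lie between pi/2 and the golden ratio: the
  first case needs t^2 \<le> \<delta> (t + \<delta>), the second needs pi \<delta> \<le> 2 t. The
  value 8/5 satisfies both.\<close>
proof (cases "t \<le> 8 / 5 * \<delta>")
  case True
  have n: "real n > 0" using assms(1) by simp
  have \<delta>: "0 < \<delta>" "\<delta> \<le> pi / 4" using assms(1) by (auto simp: \<delta>_def field_simps)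
  have "t + \<delta> \<le> pi / 2 + pi / 4" using \<delta>(2) assms(3) by (rule add_mono[rotated])
  then have sum_le: "t + \<delta> \<le> pi" using pi_ge_two by linarith
  \<comment> \<open>The same \<open>sin u\<close> is a factor of cos t - cos \<delta> = 2 sin((t +
    \<delta>)/2) sin((\<delta> - t)/2), so it can be kept on both sides and only sin((t +
    \<delta>)/2) needs a lower bound.\<close>
  define u where "u = (\<delta> - t) / 2"
  have "real n * u = pi / 2 - real n * t / 2"
    using n by (simp add: u_def \<delta>_def field_simps)
  then have "\<bar>cos (real n * t / 2)\<bar> = \<bar>sin (real n * u)\<bar>"
    by (simp add: sin_diff)
  also have "\<dots> \<le> real n * \<bar>sin u\<bar>" by (rule abs_sin_of_nat_mult_le)
  finally have 1: "\<bar>cos (real n * t / 2)\<bar> \<le> real n * \<bar>sin u\<bar>" .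
  have "t\<^sup>2 \<le> \<delta> * (t + \<delta>)"
  proof -
    have "\<delta> * (t + \<delta>) - t\<^sup>2 = (8 / 5 * \<delta> - t) * (t + 3 / 5 * \<delta>) + \<delta> * \<delta> / 25"
      by (simp add: field_simps power2_eq_square)
    also have "\<dots> \<ge> 0"
      using True \<delta> assms by (intro add_nonneg_nonneg mult_nonneg_nonneg) auto
    finally show ?thesis by simp
  qed
  then have "real n * t\<^sup>2 \<le> real n * (\<delta> * (t + \<delta>))" using n by simp
  also have "\<dots> = pi * (t + \<delta>)" using n by (simp add: \<delta>_def)
  also have "\<dots> \<le> pi * (pi * sin ((t + \<delta>) / 2))"
  proof -
    have "(t + \<delta>) / 2 \<le> pi / 2" using sum_le by simp
    then show ?thesis
      using sin_chord_le[of "(t + \<delta>) / 2" "pi / 2"] \<delta>(1) assms(2) by simp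
  qed
  finally have 2: "real n * t\<^sup>2 \<le> pi\<^sup>2 * sin ((t + \<delta>) / 2)" by (simp add: power2_eq_square mult.assoc)
  have s: "sin ((t + \<delta>) / 2) \<ge> 0" using \<delta>(1) assms(2) sum_le by (intro sin_ge_zero) auto
  have "2 * \<bar>cos (real n * t / 2)\<bar> * t\<^sup>2 \<le> 2 * (real n * \<bar>sin u\<bar>) * t\<^sup>2"
    using 1 by (intro mult_right_mono) auto
  also have "\<dots> = 2 * \<bar>sin u\<bar> * (real n * t\<^sup>2)" by simp
  also have "\<dots> \<le> 2 * \<bar>sin u\<bar> * (pi\<^sup>2 * sin ((t + \<delta>) / 2))"
    using 2 by (intro mult_left_mono) auto
  also have "\<dots> = pi\<^sup>2 * \<bar>cos t - cos \<delta>\<bar>"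
    unfolding cos_diff_cos[of t \<delta>] u_def[symmetric] using s by (simp add: abs_mult)
  finally show ?thesis .
next
  case False
  have \<delta>: "0 < \<delta>" using assms(1) by (auto simp: \<delta>_def)
  \<comment> \<open>The chord ends at pi/4 because t/2 \<le> pi/4; this makes the resulting bound 4
    t^2 \<le> pi^2 (1 - cos t) sharp at t = pi/2.\<close>
  have "t * sin (pi / 4) \<le> pi / 2 * sin (t / 2)"
    using sin_chord_le[of "t / 2" "pi / 4"] assms by simp
  then have "(t * sin (pi / 4))\<^sup>2 \<le> (pi / 2 * sin (t / 2))\<^sup>2"
    using assms by (intro power_mono mult_nonneg_nonneg sin_ge_zero) auto
  moreover have "(sin (pi / 4))\<^sup>2 = 1 / 2" by (simp add: sin_45 power_divide)
  ultimately have "2 * t\<^sup>2 \<le> pi\<^sup>2 * (sin (t / 2))\<^sup>2"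
    by (simp add: power_mult_distrib power_divide)
  moreover have "1 - cos t = 2 * (sin (t / 2))\<^sup>2"
    using cos_double_sin[of "t / 2"] by simp
  ultimately have 1: "4 * t\<^sup>2 \<le> pi\<^sup>2 * (1 - cos t)" by simp
  have "(sin (\<delta> / 2))\<^sup>2 \<le> (\<delta> / 2)\<^sup>2"
    using abs_sin_x_le_abs_x[of "\<delta> / 2"] by (simp only: abs_le_square_iff)
  moreover have "1 - cos \<delta> = 2 * (sin (\<delta> / 2))\<^sup>2"
    using cos_double_sin[of "\<delta> / 2"] by simp
  ultimately have "1 - cos \<delta> \<le> \<delta>\<^sup>2 / 2" by (simp add: power_divide)
  then have "pi\<^sup>2 * (1 - cos \<delta>) \<le> pi\<^sup>2 * (\<delta>\<^sup>2 / 2)" by (intro mult_left_mono) auto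
  also have "\<dots> \<le> (16 / 5)\<^sup>2 * ((5 / 8 * t)\<^sup>2 / 2)"
  proof (intro mult_mono divide_right_mono power_mono)
    show "pi \<le> 16 / 5" using pi_approx(2) by simp
  qed (use False \<delta> in auto)
  finally have 2: "pi\<^sup>2 * (1 - cos \<delta>) \<le> 2 * t\<^sup>2" by (simp add: power2_eq_square)
  have "2 * \<bar>cos (real n * t / 2)\<bar> * t\<^sup>2 \<le> 2 * 1 * t\<^sup>2"
    by (intro mult_mono) auto
  also have "\<dots> \<le> pi\<^sup>2 * (cos \<delta> - cos t)" using 1 2 by (simp add: algebra_simps)
  also have "\<dots> \<le> pi\<^sup>2 * \<bar>cos t - cos \<delta>\<bar>" by (intro mult_left_mono) auto
  finally show ?thesis .
qed

lemma sin_jackson_angle_le: "sin (jackson_angle d) * (real d + 2) \<le> pi"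
proof -
  have "sin (jackson_angle d) \<le> jackson_angle d"
    by (rule sin_x_le_x) (simp add: jackson_angle_def)
  then show ?thesis by (simp add: jackson_angle_def field_simps)
qed

lemma continuous_jackson_kernel [continuous_intros]:
  fixes f :: "real \<Rightarrow> real"
  shows "continuous_on A f \<Longrightarrow> continuous_on A (\<lambda>x. jackson_kernel d (f x))"
  unfolding jackson_kernel_def by (auto intro!: continuous_intros)

text \<open>Multiplying \<open>cos_half_mult_le\<close> by N sin \<delta> \<le> pi and squaring
  yields exactly the two sides of the closed form, up to powers of N and t.\<close>

lemma jackson_kernel_le_near:
  assumes "d \<ge> 2" "0 < t" "t \<le> pi / 2"
  shows "4 * (real d + 2) ^ 3 * \<bar>jackson_kernel d t\<bar> * t ^ 4 \<le> pi ^ 6"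
proof -
  define N where "N = real d + 2"
  define \<delta> where "\<delta> = jackson_angle d"
  note \<delta> = jackson_angle_bounds[OF assms(1), folded \<delta>_def]
  have s: "sin \<delta> \<ge> 0" using \<delta> by (intro sin_ge_zero) auto
  have N: "N > 0" by (simp add: N_def)
  have off: "4 * N ^ 3 * \<bar>jackson_kernel d t\<bar> * t ^ 4 \<le> pi ^ 6"
    if t: "0 < t" "t \<le> pi / 2" "t \<noteq> \<delta>" for t
  proof -
    have "cos t \<noteq> cos \<delta>"
      using t \<delta> cos_inj_pi[of t \<delta>] by auto
    then have pos: "(cos t - cos \<delta>)\<^sup>2 > 0" by simp
    have "2 * \<bar>cos (N * t / 2)\<bar> * t\<^sup>2 \<le> pi\<^sup>2 * \<bar>cos t - cos \<delta>\<bar>"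
      using cos_half_mult_le[of "d + 2" t] assms(1) t by (simp add: \<delta>_def jackson_angle_def N_def add_ac)
    then have "(sin \<delta> * N) * (2 * \<bar>cos (N * t / 2)\<bar> * t\<^sup>2) \<le> pi * (pi\<^sup>2 * \<bar>cos t - cos \<delta>\<bar>)"
    proof (rule mult_mono[rotated])
      show "sin \<delta> * N \<le> pi"
        using sin_jackson_angle_le[of d] unfolding N_def \<delta>_def .
    qed auto
    then have "((sin \<delta> * N) * (2 * \<bar>cos (N * t / 2)\<bar> * t\<^sup>2))\<^sup>2 \<le> (pi * (pi\<^sup>2 * \<bar>cos t - cos \<delta>\<bar>))\<^sup>2"
      using s N by (intro power_mono) auto
    then have "4 * N\<^sup>2 * t ^ 4 * ((sin \<delta>)\<^sup>2 * (cos (N * t / 2))\<^sup>2) \<le> pi ^ 6 * (cos t - cos \<delta>)\<^sup>2"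
      by (simp add: power_mult_distrib mult_ac flip: power_mult power_add)
    moreover have "(sin \<delta>)\<^sup>2 * (cos (N * t / 2))\<^sup>2 = N * (cos t - cos \<delta>)\<^sup>2 * \<bar>jackson_kernel d t\<bar>"
    proof -
      have "N * (cos t - cos \<delta>)\<^sup>2 * \<bar>jackson_kernel d t\<bar> = \<bar>N * (cos t - cos \<delta>)\<^sup>2 * jackson_kernel d t\<bar>"
        using N by (simp add: abs_mult)
      also have "\<dots> = (sin \<delta>)\<^sup>2 * (cos (N * t / 2))\<^sup>2"
        unfolding N_def \<delta>_def jackson_kernel_closed_form[OF assms(1)] by simp
      finally show ?thesis by simp
    qed
    moreover have "(4 * N ^ 3 * \<bar>jackson_kernel d t\<bar> * t ^ 4) * (cos t - cos \<delta>)\<^sup>2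
        = 4 * N\<^sup>2 * t ^ 4 * (N * (cos t - cos \<delta>)\<^sup>2 * \<bar>jackson_kernel d t\<bar>)"
      by (simp add: power3_eq_cube power2_eq_square)
    ultimately have "(4 * N ^ 3 * \<bar>jackson_kernel d t\<bar> * t ^ 4) * (cos t - cos \<delta>)\<^sup>2
        \<le> pi ^ 6 * (cos t - cos \<delta>)\<^sup>2"
      by (simp only:)
    then show ?thesis using pos by simp
  qed
  \<comment> \<open>The closed form is void at t = \<delta>, where the bound follows by continuity.\<close>
  show ?thesis
  proof (cases "t = \<delta>")
    case False
    then show ?thesis using off assms unfolding N_def by blast
  next
    case True
    let ?f = "\<lambda>t. 4 * N ^ 3 * \<bar>jackson_kernel d t\<bar> * t ^ 4"
    have "continuous_on UNIV ?f" by (intro continuous_intros)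
    then have "(?f \<longlongrightarrow> ?f \<delta>) (at \<delta>)"
      by (simp add: continuous_on_eq_continuous_at continuous_at)
    moreover have "eventually (\<lambda>t. ?f t \<le> pi ^ 6) (at \<delta>)"
    proof -
      have "eventually (\<lambda>t. t \<in> {0<..<pi / 2}) (at \<delta>)"
        using \<delta> pi_gt_zero by (intro eventually_at_in_open') (auto simp: field_simps)
      moreover have "eventually (\<lambda>t. t \<noteq> \<delta>) (at \<delta>)" by (simp add: eventually_neq_at_within)
      ultimately show ?thesis by eventually_elim (use off in auto)
    qed
    ultimately have "?f \<delta> \<le> pi ^ 6" by (rule tendsto_upperbound) simp
    then show ?thesis using True unfolding N_def by simp
  qed
qed

text \<open>Here cos t \<le> 0 while cos \<delta> is at least sqrt 2 / 2, so the squared denominator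
  is at least 1/2 and the oscillating numerator can be bounded by 1.\<close>

lemma jackson_kernel_le_far:
  assumes "d \<ge> 2" "pi / 2 \<le> t" "t \<le> pi"
  shows "(real d + 2) ^ 3 * \<bar>jackson_kernel d t\<bar> \<le> 2 * pi\<^sup>2"
proof -
  define N where "N = real d + 2"
  define \<delta> where "\<delta> = jackson_angle d"
  note \<delta> = jackson_angle_bounds[OF assms(1), folded \<delta>_def]
  have s: "sin \<delta> \<ge> 0" using \<delta> by (intro sin_ge_zero) auto
  have N: "N > 0" by (simp add: N_def)
  have "cos t \<le> cos (pi / 2)" using assms by (intro cos_monotone_0_pi_le) auto
  moreover have "cos (pi / 4) \<le> cos \<delta>" using \<delta> by (intro cos_monotone_0_pi_le) auto
  ultimately have "sqrt 2 / 2 \<le> cos \<delta> - cos t" by (simp add: cos_45)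
  then have "(sqrt 2 / 2)\<^sup>2 \<le> (cos \<delta> - cos t)\<^sup>2" by (intro power_mono) auto
  then have half: "1 / 2 \<le> (cos t - cos \<delta>)\<^sup>2" by (simp add: power_divide power2_commute)
  have "N * (1 / 2) * \<bar>jackson_kernel d t\<bar> \<le> N * (cos t - cos \<delta>)\<^sup>2 * \<bar>jackson_kernel d t\<bar>"
    using half N by (intro mult_right_mono mult_left_mono) auto
  also have "\<dots> = \<bar>N * (cos t - cos \<delta>)\<^sup>2 * jackson_kernel d t\<bar>"
    using N by (simp add: abs_mult)
  also have "\<dots> = (sin \<delta>)\<^sup>2 * (cos (N * t / 2))\<^sup>2"
    unfolding N_def \<delta>_def jackson_kernel_closed_form[OF assms(1)] by simp
  also have "\<dots> \<le> (sin \<delta>)\<^sup>2 * 1"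
    by (intro mult_left_mono) (auto simp: abs_square_le_1)
  finally have "N\<^sup>2 * (N * (1 / 2) * \<bar>jackson_kernel d t\<bar>) \<le> N\<^sup>2 * (sin \<delta>)\<^sup>2"
    by (intro mult_left_mono) auto
  also have "\<dots> = (sin \<delta> * N)\<^sup>2" by (simp add: power_mult_distrib)
  also have "\<dots> \<le> pi\<^sup>2"
    using sin_jackson_angle_le[of d] s N unfolding N_def[symmetric] \<delta>_def[symmetric]
    by (intro power_mono) auto
  finally show ?thesis unfolding N_def[symmetric]
    by (simp add: power2_eq_square power3_eq_cube mult_ac)
qed

lemma pow4_mult_diff_le:
  fixes x c :: real
  assumes "0 \<le> x" "x \<le> c"
  shows "8 * x ^ 4 * (c - x) \<le> c ^ 5"
proof -
  \<comment> \<open>The maximum of x^4 (c - x) is attained at x = 4 c / 5.\<close>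
  have "256 / 3125 * c ^ 5 - x ^ 4 * (c - x)
      = (x - 4 / 5 * c)\<^sup>2 * (x ^ 3 + 3 / 5 * c * x\<^sup>2 + 8 / 25 * c\<^sup>2 * x + 16 / 125 * c ^ 3)"
    by (simp add: algebra_simps eval_nat_numeral)
  also have "\<dots> \<ge> 0" using assms by (intro mult_nonneg_nonneg add_nonneg_nonneg) auto
  finally have "8 * x ^ 4 * (c - x) \<le> 2048 / 3125 * c ^ 5" by linarith
  also have "\<dots> \<le> 1 * c ^ 5" using assms by (intro mult_right_mono) auto
  finally show ?thesis by simp
qed

text \<open>Up to pi/2 the fourth-power decay suffices and \<open>pi - x\<close> is merely bounded
  by pi. Beyond that the kernel bound is constant in \<open>t\<close>, and the factor
  \<open>pi - x\<close> makes up for the loss through \<open>pow4_mult_diff_le\<close>. In the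
  application \<open>x\<close> is the distance \<Delta>.\<close>

lemma jackson_kernel_le:
  assumes "d \<ge> 2" "0 < x" "x \<le> t" "t \<le> pi"
  shows "4 * (real d + 2) ^ 3 * x ^ 4 * (pi - x) * \<bar>jackson_kernel d t\<bar> \<le> pi ^ 7"
proof (cases "t \<le> pi / 2")
  case True
  have "4 * (real d + 2) ^ 3 * x ^ 4 * (pi - x) * \<bar>jackson_kernel d t\<bar>
      = (4 * (real d + 2) ^ 3 * \<bar>jackson_kernel d t\<bar>) * x ^ 4 * (pi - x)" by simp
  also have "\<dots> \<le> (4 * (real d + 2) ^ 3 * \<bar>jackson_kernel d t\<bar>) * t ^ 4 * pi"
    using assms by (intro mult_mono mult_left_mono power_mono) auto
  also have "\<dots> \<le> pi ^ 6 * pi"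
    using jackson_kernel_le_near[of d t] assms True by (intro mult_right_mono) auto
  finally show ?thesis by (simp add: eval_nat_numeral)
next
  case False
  have "4 * (real d + 2) ^ 3 * x ^ 4 * (pi - x) * \<bar>jackson_kernel d t\<bar>
      = 4 * x ^ 4 * (pi - x) * ((real d + 2) ^ 3 * \<bar>jackson_kernel d t\<bar>)" by simp
  also have "\<dots> \<le> 4 * x ^ 4 * (pi - x) * (2 * pi\<^sup>2)"
    using assms False by (intro mult_left_mono jackson_kernel_le_far mult_nonneg_nonneg) auto
  also have "\<dots> = (8 * x ^ 4 * (pi - x)) * pi\<^sup>2" by simp
  also have "\<dots> \<le> pi ^ 5 * pi\<^sup>2"
    using assms by (intro mult_right_mono pow4_mult_diff_le) auto
  finally show ?thesis by (simp add: eval_nat_numeral)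
qed

section \<open>Integral representation of the Chebyshev-Jackson expansion\<close>

lemma cheb_coeff_eq_integral_cos:
  assumes "- 1 \<le> a" "a < b" "b \<le> 1"
  shows "cheb_coeff a b p j
    = 2 / pi * integral {arccos b..arccos a} (\<lambda>\<phi>. poly p (cos \<phi>) * cos (real j * \<phi>))"
proof -
  let ?f = "\<lambda>\<phi>. poly p (cos \<phi>) * cos (real j * \<phi>)"
  have less: "arccos b < arccos a" using assms by (intro arccos_less_arccos) auto
  have sub: "((\<lambda>t. inverse (- sqrt (1 - t\<^sup>2)) *\<^sub>R ?f (arccos t)) has_integral
      (integral {arccos a..arccos b} ?f - integral {arccos b..arccos a} ?f)) {a..b}"
  proof (rule has_integral_substitution_general[where s = "{-1, 1}" and c = 0 and d = pi])
    show "arccos ` {a..b} \<subseteq> {0..pi}"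
      using assms by (auto simp: arccos_lbound arccos_ubound)
    show "continuous_on {a..b} arccos"
      using assms by (intro continuous_on_arccos continuous_intros) auto
    show "(arccos has_real_derivative inverse (- sqrt (1 - t\<^sup>2))) (at t within {a..b})"
      if "t \<in> {a..b} - {-1, 1}" for t
      using that assms by (intro has_field_derivative_at_within[OF DERIV_arccos]) auto
  qed (use assms in \<open>auto intro!: continuous_intros\<close>)
  \<comment> \<open>\<open>arccos\<close> is decreasing, so one of the two integrals from the
    substitution rule runs over an empty interval; the minus sign left over cancels the one in the
    derivative of \<open>arccos\<close>.\<close>
  have "integral {arccos a..arccos b} ?f = 0" using less by simp
  then have "((\<lambda>t. - (inverse (- sqrt (1 - t\<^sup>2)) *\<^sub>R ?f (arccos t))) has_integral
      integral {arccos b..arccos a} ?f) {a..b}"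
    using has_integral_neg[OF sub] by (simp only: minus_diff_eq diff_0_right)
  also have "?this \<longleftrightarrow> ((\<lambda>t. poly p t * poly (cheb_T j) t / sqrt (1 - t\<^sup>2)) has_integral
      integral {arccos b..arccos a} ?f) {a..b}"
  proof (intro has_integral_cong)
    fix t assume "t \<in> {a..b}"
    then have "cos (arccos t) = t" using assms by (intro cos_arccos) auto
    \<comment> \<open>At t = -1 and t = 1 both sides are 0 by the convention for division by zero,
      so the congruence holds on the whole closed interval.\<close>
    then show "- (inverse (- sqrt (1 - t\<^sup>2)) *\<^sub>R ?f (arccos t))
        = poly p t * poly (cheb_T j) t / sqrt (1 - t\<^sup>2)"
      using poly_cheb_T_cos[of j "arccos t"] by (simp add: divide_inverse)
  qed
  finally show ?thesis unfolding cheb_coeff_def by (simp add: integral_unique)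
qed

text \<open>The finite sum is moved under the integral, and the product formula for cosines splits
  each term into one at \<theta> - \<phi> and one at \<theta> + \<phi>; this is convolution of an
  even function with the kernel, folded onto [0, pi].\<close>

lemma q_fun_eq_integral:
  assumes "- 1 \<le> a" "a < b" "b \<le> 1"
  shows "((\<lambda>\<phi>. poly p (cos \<phi>) * (jackson_kernel d (\<theta> - \<phi>) + jackson_kernel d (\<theta> + \<phi>)) / pi)
    has_integral q_fun a b d p \<theta>) {arccos b..arccos a}"
proof -
  let ?I = "{arccos b..arccos a}"
  have coeff: "((\<lambda>\<phi>. 2 / pi * (poly p (cos \<phi>) * cos (real j * \<phi>))) has_integral cheb_coeff a b p j) ?I" for j
    unfolding cheb_coeff_eq_integral_cos[OF assms]
    by (intro has_integral_mult_right integrable_integral integrable_continuous_real continuous_intros)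
  have "((\<lambda>\<phi>. 2 / pi * (poly p (cos \<phi>) * cos (real 0 * \<phi>)) * (1 / 2)
      + (\<Sum>j = 1..d. 2 / pi * (poly p (cos \<phi>) * cos (real j * \<phi>)) * (jackson_rho j d * cos (real j * \<theta>))))
    has_integral cheb_coeff a b p 0 * (1 / 2)
      + (\<Sum>j = 1..d. cheb_coeff a b p j * (jackson_rho j d * cos (real j * \<theta>)))) ?I"
    by (intro has_integral_add has_integral_sum has_integral_mult_left coeff) auto
  also have "cheb_coeff a b p 0 * (1 / 2)
      + (\<Sum>j = 1..d. cheb_coeff a b p j * (jackson_rho j d * cos (real j * \<theta>))) = q_fun a b d p \<theta>"
    by (simp add: q_fun_def cheb_jackson_def poly_cheb_T_cos mult_ac)
  also have "(\<lambda>\<phi>. 2 / pi * (poly p (cos \<phi>) * cos (real 0 * \<phi>)) * (1 / 2)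
      + (\<Sum>j = 1..d. 2 / pi * (poly p (cos \<phi>) * cos (real j * \<phi>)) * (jackson_rho j d * cos (real j * \<theta>))))
    = (\<lambda>\<phi>. poly p (cos \<phi>) * (jackson_kernel d (\<theta> - \<phi>) + jackson_kernel d (\<theta> + \<phi>)) / pi)"
  proof
    fix \<phi>
    have prod: "2 * (cos (real j * \<phi>) * cos (real j * \<theta>)) = cos (real j * (\<theta> - \<phi>)) + cos (real j * (\<theta> + \<phi>))" for j
      by (simp add: cos_add cos_diff algebra_simps)
    have "jackson_kernel d (\<theta> - \<phi>) + jackson_kernel d (\<theta> + \<phi>)
      = 1 + (\<Sum>j = 1..d. jackson_rho j d * (cos (real j * (\<theta> - \<phi>)) + cos (real j * (\<theta> + \<phi>))))"
      by (simp add: jackson_kernel_def distrib_left sum.distrib)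
    also have "\<dots> = 1 + (\<Sum>j = 1..d. jackson_rho j d * (2 * (cos (real j * \<phi>) * cos (real j * \<theta>))))"
      by (simp only: prod)
    finally show "2 / pi * (poly p (cos \<phi>) * cos (real 0 * \<phi>)) * (1 / 2)
      + (\<Sum>j = 1..d. 2 / pi * (poly p (cos \<phi>) * cos (real j * \<phi>)) * (jackson_rho j d * cos (real j * \<theta>)))
      = poly p (cos \<phi>) * (jackson_kernel d (\<theta> - \<phi>) + jackson_kernel d (\<theta> + \<phi>)) / pi"
      by (simp add: distrib_left sum_distrib_left add_divide_distrib sum_divide_distrib mult_ac)
  qed
  finally show ?thesis .
qed

section \<open>Sup norm, symmetries of the kernel, and the error estimate\<close>

text \<open>A real-valued supremum dominates its values only when they are bounded above;
  compactness of [0, pi] provides the bound.\<close>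

lemma abs_g_fun_le_Linf:
  assumes "\<phi> \<in> {0<..<pi}"
  shows "\<bar>g_fun a b p \<phi>\<bar> \<le> Linf_norm 0 pi (g_fun a b p)"
proof -
  have "compact ((\<lambda>x. poly p (cos x)) ` {0..pi})"
    by (intro compact_continuous_image continuous_intros) auto
  then have "bounded ((\<lambda>x. poly p (cos x)) ` {0..pi})"
    by (rule compact_imp_bounded)
  then obtain B where B: "\<And>x. x \<in> {0..pi} \<Longrightarrow> \<bar>poly p (cos x)\<bar> \<le> B"
    unfolding bounded_iff by fastforce
  have "\<bar>g_fun a b p x\<bar> \<le> B" if "x \<in> {0<..<pi}" for x
    using B[of x] that by (auto simp: g_fun_def h_tilde_def step_h_def)
  then show ?thesis
    unfolding Linf_norm_def using assms by (intro cSUP_upper bdd_aboveI2) auto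
qed

lemma jackson_kernel_minus: "jackson_kernel d (- t) = jackson_kernel d t"
  by (simp add: jackson_kernel_def)

text \<open>Brings arguments \<theta> + \<phi> between pi and 2 pi back into the range of
  \<open>jackson_kernel_le\<close>.\<close>

lemma jackson_kernel_reflect: "jackson_kernel d (2 * pi - t) = jackson_kernel d t"
proof -
  have "cos (real j * (2 * pi - t)) = cos (real j * t)" for j
    using cos_2npi[of j] sin_2npi[of j] by (simp add: right_diff_distrib cos_diff mult_ac)
  then show ?thesis by (simp add: jackson_kernel_def)
qed

theorem theorem3p3:
  fixes a b \<alpha> \<beta> \<theta> :: real and p :: "real poly" and M d :: nat
  assumes "- 1 \<le> a" and "a < b" and "b \<le> 1"
    and "M \<ge> 1" and "degree p \<le> M - 1"
    and "\<alpha> = arccos a" and "\<beta> = arccos b"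
    and "\<theta> \<in> {0..pi} - {\<beta>..\<alpha>}"
    and "d \<ge> 2"
  shows "\<bar>q_fun a b d p \<theta> - g_fun a b p \<theta>\<bar>
    \<le> pi ^ 6 * Linf_norm 0 pi (g_fun a b p)
      / (2 * Delta_dist \<alpha> \<beta> \<theta> ^ 4 * (real d + 2) ^ 3)"
proof -
  define D where "D = Delta_dist \<alpha> \<beta> \<theta>"
  define L where "L = Linf_norm 0 pi (g_fun a b p)"
  \<comment> \<open>\<open>jackson_kernel_le\<close> at x = D, solved for the kernel. The divisor
    \<open>pi - D\<close> is cancelled at the end by the length of the integration interval.\<close>
  define B where "B = pi ^ 7 / (4 * (real d + 2) ^ 3 * D ^ 4 * (pi - D))"
  have \<beta>\<alpha>: "\<beta> < \<alpha>" using assms by (auto intro: arccos_less_arccos)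
  have rng: "0 \<le> \<beta>" "\<alpha> \<le> pi" using assms by (auto intro: arccos_lbound arccos_ubound)
  have D0: "D > 0" using assms(8) \<beta>\<alpha> by (auto simp: D_def Delta_dist_def)
  \<comment> \<open>The interval from \<beta> to \<alpha> and the gap between it and \<theta> fit
    side by side into [0, pi].\<close>
  have D1: "\<alpha> - \<beta> \<le> pi - D" using assms(8) rng \<beta>\<alpha>
    by (auto simp: D_def Delta_dist_def min_def abs_if)
  have D2: "D \<le> \<bar>\<theta> - \<phi>\<bar>" if "\<phi> \<in> {\<beta>..\<alpha>}" for \<phi>
    using assms(8) that by (auto simp: D_def Delta_dist_def min_def abs_if)
  have Dpi: "pi - D > 0" using D1 \<beta>\<alpha> by linarith
  have K: "\<bar>jackson_kernel d t\<bar> \<le> B" if "D \<le> t" "t \<le> pi" for t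
    using jackson_kernel_le[of d D t] assms(9) D0 Dpi that by (simp add: B_def field_simps)
  have K1: "\<bar>jackson_kernel d (\<theta> - \<phi>)\<bar> \<le> B" if "\<phi> \<in> {\<beta>..\<alpha>}" for \<phi>
  proof -
    have "jackson_kernel d (\<theta> - \<phi>) = jackson_kernel d \<bar>\<theta> - \<phi>\<bar>"
      using jackson_kernel_minus[of d "\<theta> - \<phi>"] by (simp add: abs_if)
    then show ?thesis using K[of "\<bar>\<theta> - \<phi>\<bar>"] D2[OF that] that rng assms(8) by auto
  qed
  \<comment> \<open>Both \<theta> + \<phi> and 2 pi - (\<theta> + \<phi>) = (pi - \<theta>) + (pi -
    \<phi>) are at least |\<theta> - \<phi>|, hence at least D.\<close>
  have K2: "\<bar>jackson_kernel d (\<theta> + \<phi>)\<bar> \<le> B" if "\<phi> \<in> {\<beta>..\<alpha>}" for \<phi>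
  proof (cases "\<theta> + \<phi> \<le> pi")
    case True
    then show ?thesis using K[of "\<theta> + \<phi>"] D2[OF that] that rng assms(8) by auto
  next
    case False
    then show ?thesis
      using K[of "2 * pi - (\<theta> + \<phi>)"] D2[OF that] that rng assms(8)
      unfolding jackson_kernel_reflect by auto
  qed
  have P: "\<bar>poly p (cos \<phi>)\<bar> \<le> L" if "\<phi> \<in> {\<beta><..<\<alpha>}" for \<phi>
  proof -
    have "cos \<phi> < cos \<beta>" "cos \<alpha> < cos \<phi>"
      using that rng by (auto intro!: cos_monotone_0_pi)
    then have "g_fun a b p \<phi> = poly p (cos \<phi>)"
      using assms by (auto simp: g_fun_def h_tilde_def step_h_def cos_arccos)
    then show ?thesis
      using abs_g_fun_le_Linf[of \<phi> a b p] that rng unfolding L_def by auto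
  qed
  have L0: "L \<ge> 0"
    using P[of "(\<alpha> + \<beta>) / 2"] \<beta>\<alpha> abs_ge_zero[of "poly p (cos ((\<alpha> + \<beta>) / 2))"] by auto
  have B0: "B \<ge> 0" unfolding B_def using D0 Dpi by (intro divide_nonneg_nonneg mult_nonneg_nonneg) auto
  \<comment> \<open>At \<alpha> and \<beta> the value of g is only half of p(cos \<phi>), and these
    points may be 0 or pi, outside the range of the supremum; continuity extends the bound to
    them.\<close>
  have P': "\<bar>poly p (cos \<phi>)\<bar> \<le> L" if "\<phi> \<in> {\<beta>..\<alpha>}" for \<phi>
  proof -
    have "closure {\<beta><..<\<alpha>} = {\<beta>..\<alpha>}" using \<beta>\<alpha> by simp
    moreover have "continuous_on (closure {\<beta><..<\<alpha>}) (\<lambda>\<phi>. \<bar>poly p (cos \<phi>)\<bar>)"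
      by (intro continuous_intros)
    ultimately show ?thesis
      using continuous_le_on_closure[of "{\<beta><..<\<alpha>}" "\<lambda>\<phi>. \<bar>poly p (cos \<phi>)\<bar>" \<phi> L] P that by blast
  qed
  have int: "((\<lambda>\<phi>. poly p (cos \<phi>) * (jackson_kernel d (\<theta> - \<phi>) + jackson_kernel d (\<theta> + \<phi>)) / pi)
    has_integral q_fun a b d p \<theta>) (cbox \<beta> \<alpha>)"
    using q_fun_eq_integral[OF assms(1-3)] assms(6,7) by simp
  have "norm (q_fun a b d p \<theta>) \<le> L * (B + B) / pi * measure lborel (cbox \<beta> \<alpha>)"
  proof (rule has_integral_bound[OF _ int])
    show "0 \<le> L * (B + B) / pi" using L0 B0 by simp
    fix \<phi> assume "\<phi> \<in> cbox \<beta> \<alpha>"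
    then have \<phi>: "\<phi> \<in> {\<beta>..\<alpha>}" by simp
    have "\<bar>jackson_kernel d (\<theta> - \<phi>) + jackson_kernel d (\<theta> + \<phi>)\<bar> \<le> B + B"
      using K1[OF \<phi>] K2[OF \<phi>] by linarith
    then have "\<bar>poly p (cos \<phi>)\<bar> * \<bar>jackson_kernel d (\<theta> - \<phi>) + jackson_kernel d (\<theta> + \<phi>)\<bar> \<le> L * (B + B)"
      using P'[OF \<phi>] L0 by (intro mult_mono) auto
    then show "norm (poly p (cos \<phi>) * (jackson_kernel d (\<theta> - \<phi>) + jackson_kernel d (\<theta> + \<phi>)) / pi)
        \<le> L * (B + B) / pi"
      by (simp add: abs_mult divide_right_mono)
  qed
  also have "\<dots> \<le> L * (B + B) / pi * (pi - D)"
    using D1 \<beta>\<alpha> L0 B0 by (intro mult_left_mono) auto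
  also have "\<dots> = pi ^ 6 * L / (2 * D ^ 4 * (real d + 2) ^ 3)"
  proof -
    have "B * (pi - D) = pi ^ 7 / (4 * (real d + 2) ^ 3 * D ^ 4)"
      using Dpi by (simp add: B_def)
    then have "L * (B + B) / pi * (pi - D) = 2 * L * (pi ^ 7 / (4 * (real d + 2) ^ 3 * D ^ 4)) / pi"
      by (metis (no_types, lifting) mult.assoc mult.commute mult_2 times_divide_eq_left)
    also have "\<dots> = pi ^ 6 * L / (2 * D ^ 4 * (real d + 2) ^ 3)"
      by (simp add: eval_nat_numeral mult_ac)
    finally show ?thesis .
  qed
  finally have "\<bar>q_fun a b d p \<theta>\<bar> \<le> pi ^ 6 * L / (2 * D ^ 4 * (real d + 2) ^ 3)" by simp
  moreover have "g_fun a b p \<theta> = 0"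
  proof -
    have "arccos (cos \<theta>) = \<theta>" using assms(8) by (intro arccos_cos) auto
    moreover have "\<not> (a \<le> cos \<theta> \<and> cos \<theta> \<le> b)"
    proof
      assume "a \<le> cos \<theta> \<and> cos \<theta> \<le> b"
      then have "arccos b \<le> arccos (cos \<theta>)" "arccos (cos \<theta>) \<le> arccos a"
        using assms(1,3) by (auto intro!: arccos_le_arccos)
      with \<open>arccos (cos \<theta>) = \<theta>\<close> show False using assms(6-8) by auto
    qed
    ultimately show ?thesis using assms(2) by (auto simp: g_fun_def h_tilde_def step_h_def)
  qed
  ultimately show ?thesis unfolding D_def L_def by simp
qed

end
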